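(* Let $k\ge1$ and $n\ge1$ be integers. Then $$F^k_n=F_n^{k-1}+\sum_{j=0}^{n-k}F_j^{k-1}F_{n-k-j}^k.$$
   Context: For $k\ge0$ the numbers $F_n^k$ are defined by $F_n^k=0$ for $n<0$, $F_0^k=1$, and $F_n^k=F_{n-1}^k+\cdots+F_{n-k}^k$ for $n>0$ (so $F_n^0=0$ for $n\neq0$). Equivalently $F_n^k$ is the number of tilings of an $n\times1$ board by tiles of lengths in $\{1,\dots,k\}$. *)

theory Defs
  imports Main
begin

text \<open>\<open>F k n\<close> is the number written $F_n^k$; the lower index ranges over the integers, since
  it is allowed to be negative.\<close>

function F :: "nat \<Rightarrow> int \<Rightarrow> nat" where
  "F k n = (if n < 0 then 0 else if n = 0 then 1 else (\<Sum>i = 1..k. F k (n - int i)))"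
  by pat_completeness auto
termination
  by (relation "measure (\<lambda>(k, n). nat n)") auto

(* The unconditional equation would make the simplifier loop. *)
declare F.simps [simp del]

end

theory Submission
  imports Defs
begin

text \<open>Strong induction on \<open>n\<close>. Write \<open>S n\<close> for the sum on the right. Expanding every
  \<open>F (k - 1) j\<close> with \<open>j > 0\<close> by its recurrence shows that
  \<open>S n = F k (n - k) + (\<Sum>i = 1..k - 1. S (n - i))\<close>, which is what the recurrences for \<open>F k n\<close> and
  \<open>F (k - 1) n\<close> demand. In terms of tilings, the first tile of length \<open>k\<close> is preceded by \<open>j\<close> cells.\<close>

lemma F_neg: "n < 0 \<Longrightarrow> F k n = 0"
  by (simp add: F.simps)

lemma F_0: "F k 0 = 1"
  by (simp add: F.simps)

lemma F_pos: "n > 0 \<Longrightarrow> F k n = (\<Sum>i = 1..k. F k (n - int i))"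
  by (subst F.simps) simp

lemma sum_F_shift:
  fixes H :: "int \<Rightarrow> nat"
  assumes "i \<ge> 1"
  shows "(\<Sum>j = 1..N. F m (j - i) * H (N - j)) = (\<Sum>j = 0..N - i. F m j * H (N - i - j))"
proof -
  \<comment> \<open>For \<open>j < i\<close> the first factor has a negative index, so these terms
    vanish.\<close>
  have "(\<Sum>j = 1..N. F m (j - i) * H (N - j)) = (\<Sum>j = i..N. F m (j - i) * H (N - j))"
    using assms by (intro sum.mono_neutral_right) (auto simp: F_neg)
  also have "\<dots> = (\<Sum>j = 0..N - i. F m j * H (N - i - j))"
    by (rule sum.reindex_bij_witness[of _ "\<lambda>j. j + i" "\<lambda>j. j - i"]) auto
  finally show ?thesis .
qed

text \<open>Convolution with \<open>F m\<close> inherits its recurrence; the extra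
  \<open>H N\<close> is the term \<open>j = 0\<close>, where the recurrence of \<open>F m\<close>
  fails.\<close>

lemma sum_F_convolution:
  fixes H :: "int \<Rightarrow> nat"
  assumes "\<And>n. n < 0 \<Longrightarrow> H n = 0"
  shows "(\<Sum>j = 0..N. F m j * H (N - j))
    = H N + (\<Sum>i = 1..m. \<Sum>j = 0..N - int i. F m j * H (N - int i - j))"
proof (cases "N < 0")
  case True
  then show ?thesis by (simp add: assms)
next
  case False
  then have "{0..N} = insert 0 {1..N}" by auto
  then have "(\<Sum>j = 0..N. F m j * H (N - j)) = H N + (\<Sum>j = 1..N. F m j * H (N - j))"
    by (simp add: F_0)
  also have "(\<Sum>j = 1..N. F m j * H (N - j))
      = (\<Sum>j = 1..N. \<Sum>i = 1..m. F m (j - int i) * H (N - j))"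
    by (intro sum.cong refl) (simp add: F_pos sum_distrib_right)
  also have "\<dots> = (\<Sum>i = 1..m. \<Sum>j = 1..N. F m (j - int i) * H (N - j))"
    by (rule sum.swap)
  also have "\<dots> = (\<Sum>i = 1..m. \<Sum>j = 0..N - int i. F m j * H (N - int i - j))"
    by (intro sum.cong refl sum_F_shift) auto
  finally show ?thesis .
qed

text \<open>With \<open>n\<close> ranging over all integers, the induction hypothesis also covers
  those \<open>n - i\<close> that are not positive.\<close>

lemma F_Suc_eq:
  "F (Suc m) n = F m n + (\<Sum>j = 0..n - int (Suc m). F m j * F (Suc m) (n - int (Suc m) - j))"
proof (induction "nat n" arbitrary: n rule: less_induct)
  case less
  define S where "S n = (\<Sum>j = 0..n - int (Suc m). F m j * F (Suc m) (n - int (Suc m) - j))" for n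
  have IH: "F (Suc m) (n - int i) = F m (n - int i) + S (n - int i)" if "n > 0" "i \<ge> 1" for i
    unfolding S_def by (rule less) (use that in auto)
  have "F (Suc m) n = F m n + S n"
  proof (cases "n > 0")
    case False
    then show ?thesis by (cases "n = 0") (auto simp: S_def F_neg F_0)
  next
    case True
    have "F (Suc m) n = (\<Sum>i = 1..m. F (Suc m) (n - int i)) + F (Suc m) (n - int (Suc m))"
      using True by (simp add: F_pos)
    also have "(\<Sum>i = 1..m. F (Suc m) (n - int i)) = F m n + (\<Sum>i = 1..m. S (n - int i))"
      using True by (simp add: IH sum.distrib F_pos[of n m])
    finally have "F (Suc m) n
      = F m n + (\<Sum>i = 1..m. S (n - int i)) + F (Suc m) (n - int (Suc m))" .
    \<comment> \<open>Taking \<open>H = F (Suc m)\<close>, the extra term \<open>H N\<close> is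
      exactly the summand for \<open>i = Suc m\<close> split off above.\<close>
    moreover have "S n = F (Suc m) (n - int (Suc m)) + (\<Sum>i = 1..m. S (n - int i))"
      unfolding S_def using sum_F_convolution[of "F (Suc m)" m "n - int (Suc m)"]
      by (simp add: F_neg algebra_simps)
    ultimately show ?thesis by simp
  qed
  then show ?case by (simp add: S_def)
qed

theorem theorem2p3:
  fixes k :: nat and n :: int
  assumes "k \<ge> 1" and "n \<ge> 1"
  shows "F k n = F (k - 1) n + (\<Sum>j = 0..n - int k. F (k - 1) j * F k (n - int k - j))"
  using F_Suc_eq[of "k - 1" n] assms by simp

end
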